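(* Let $\mathcal{SG}^{\phi}$ be the product of a partially observable stochastic game with a deterministic Rabin automaton for an LTL formula $\phi$, let $\mathcal{C}_d,\mathcal{C}_a$ be finite state controllers for the defender and the adversary, and let $\mathcal{M}=\mathcal{M}^{\phi,\mathcal{C}_d,\mathcal{C}_a}$ be the resulting global Markov chain. Then the probability of satisfying $\phi$ under the policies $\mathcal{C}_d,\mathcal{C}_a$ equals the probability that paths of $\mathcal{M}$ reach $\phi$-feasible recurrent sets: $$\mathbb{P}(\mathcal{SG}^{\phi}\models\phi\mid\mathcal{C}_d,\mathcal{C}_a)=\sum_{R\in\phi\text{-}RecSets^{\mathcal{C}_d,\mathcal{C}_a}}\mathbb{P}(\pi\to R),$$ where $\pi\to R$ is the event that a path $\pi$ of $\mathcal{M}$ (started at the initial state $\bar s_0$) reaches $R$.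
   Context: **POSG.** A partially observable stochastic game is $\mathcal{SG}=(S,s_0,U_d,U_a,\mathbb{T},\mathcal{O}_d,\mathcal{O}_a,O_d,O_a,\mathcal{AP},\mathcal{L})$: $S$ is a finite state set with initial state $s_0$; $U_d,U_a$ are finite action sets of defender and adversary; $\mathbb{T}(s'|s,u_d,u_a)$ are transition probabilities; $\mathcal{O}_d,\mathcal{O}_a$ are finite observation sets; $O_*(o|s)$, $*\in\{d,a\}$, is the probability of observing $o\in\mathcal{O}_*$ in state $s$; $\mathcal{L}:S\to 2^{\mathcal{AP}}$ is a labeling by atomic propositions. **Rabin automaton.** $\phi$ is represented by a deterministic Rabin automaton $(Q,2^{\mathcal{AP}},\delta,q_0,F)$ with finite $Q$, $\delta:Q\times 2^{\mathcal{AP}}\to Q$, and $F=\{(L(i),K(i))\}_{i=1}^M$, $L(i),K(i)\subseteq Q$. A run is accepting if for some $i$ it visits $L(i)$ finitely many times and $K(i)$ infinitely often. **Product-POSG.** $\mathcal{SG}^\phi$ has states $S^\phi=S\times Q$, initial state $(s_0,q_0)$, observation functions $O_*(o|(s,q))=O_*(o|s)$, transitions $\mathbb{T}^\phi((s',q')|(s,q),u_d,u_a)=\mathbb{T}(s'|s,u_d,u_a)$ if $\delta(q,\mathcal{L}(s'))=q'$ and $0$ otherwise, and acceptance pairs $(L^\phi(i),K^\phi(i))$ with $(s,q)\in L^\phi(i)$ iff $q\in L(i)$ and $(s,q)\in K^\phi(i)$ iff $q\in K(i)$. **Finite state controller (FSC).** $\mathcal{C}_*=(G_*,g_{0_*},\mu_*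 )$, $*\in\{d,a\}$: $G_*$ is a finite set of internal states with initial state $g_{0_*}$, and $\mu_*(g'_*,u_*|g_*,o_* )$ is, for each $(g_*,o_* )\in G_*\times\mathcal{O}_*$, a probability distribution over $(g'_*,u_* )\in G_*\times U_*$. **Global Markov chain (GMC).** $\mathcal{M}$ has state space $\bar S=S^\phi\times G_d\times G_a$, initial state $\bar s_0=(s_0,q_0,g_{0_d},g_{0_a})$ and transition probabilities $$\bar{\mathbb{T}}((s',q'),g'_d,g'_a|(s,q),g_d,g_a)=\sum_{o\in\mathcal{O}_d}\sum_{o'\in\mathcal{O}_a}\sum_{u_d}\sum_{u_a}O_d(o|s)O_a(o'|s)\mu_d(g'_d,u_d|g_d,o)\mu_a(g'_a,u_a|g_a,o')\mathbb{T}^\phi((s',q')|(s,q),u_d,u_a).$$ A path of $\mathcal{M}$ is accepting if for some $i$ its $S^\phi$-component visits $L^\phi(i)$ finitely often and $K^\phi(i)$ infinitely often. $\mathbb{P}(\mathcal{SG}^\phi\models\phi\mid\mathcal{C}_d,\mathcal{C}_a)=\mathbb{P}(\mathcal{M}\models\phi)$ is the probability, under the usual path measure of $\mathcal{M}$ from $\bar s_0$, of the set of accepting paths. **$\phi$-feasible recurrent sets.** The recurrent states of $\mathcal{M}$ are partitioned into maximal recurrence classes $R_1,\dots,R_p$ (all states within a class communicate). For a class $R_k$, $R_k^S\subseteq S^\phi$ is the set of $(s,q)$-components of its states. $R_k$ is $\phi$-feasible if there is $i$ with $K^\phi(i)\cap R_k^S\neq\emptyset$ and $L^\phi(i)\cap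 R_k^S=\emptyset$. $\phi\text{-}RecSets^{\mathcal{C}_d,\mathcal{C}_a}$ is the set of $\phi$-feasible recurrence classes. *)

theory Defs
  imports "HOL-Probability.Probability"
begin

section \<open>Linear temporal logic and deterministic Rabin automata\<close>

datatype 'ap ltl =
    LTL_True
  | LTL_Prop 'ap
  | LTL_Not "'ap ltl"
  | LTL_And "'ap ltl" "'ap ltl"
  | LTL_Next "'ap ltl"
  | LTL_Until "'ap ltl" "'ap ltl"

primrec ltl_sat :: "(nat \<Rightarrow> 'ap set) \<Rightarrow> nat \<Rightarrow> 'ap ltl \<Rightarrow> bool" where
  "ltl_sat w i LTL_True \<longleftrightarrow> True"
| "ltl_sat w i (LTL_Prop p) \<longleftrightarrow> p \<in> w i"
| "ltl_sat w i (LTL_Not \<phi>) \<longleftrightarrow> \<not> ltl_sat w i \<phi>"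
| "ltl_sat w i (LTL_And \<phi> \<psi>) \<longleftrightarrow> ltl_sat w i \<phi> \<and> ltl_sat w i \<psi>"
| "ltl_sat w i (LTL_Next \<phi>) \<longleftrightarrow> ltl_sat w (Suc i) \<phi>"
| "ltl_sat w i (LTL_Until \<phi> \<psi>) \<longleftrightarrow>
     (\<exists>k\<ge>i. ltl_sat w k \<psi> \<and> (\<forall>j. i \<le> j \<and> j < k \<longrightarrow> ltl_sat w j \<phi>))"

text \<open>Each acceptance pair is \<open>(L, K)\<close>: \<open>L\<close> is to be visited finitely often, \<open>K\<close> infinitely often.\<close>

type_synonym 'q rabin_pairs = "('q set \<times> 'q set) set"

definition rabin_accepting :: "'q rabin_pairs \<Rightarrow> (nat \<Rightarrow> 'q) \<Rightarrow> bool" where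
  "rabin_accepting F r \<longleftrightarrow>
     (\<exists>(L, K) \<in> F. finite {n. r n \<in> L} \<and> infinite {n. r n \<in> K})"

record ('q, 'l) dra =
  dra_init :: 'q
  dra_delta :: "'q \<Rightarrow> 'l \<Rightarrow> 'q"
  dra_acc :: "'q rabin_pairs"

primrec dra_run :: "('q, 'l) dra \<Rightarrow> (nat \<Rightarrow> 'l) \<Rightarrow> nat \<Rightarrow> 'q" where
  "dra_run A w 0 = dra_init A"
| "dra_run A w (Suc n) = dra_delta A (dra_run A w n) (w n)"

definition dra_represents :: "('q, 'ap set) dra \<Rightarrow> 'ap ltl \<Rightarrow> bool" where
  "dra_represents A \<phi> \<longleftrightarrow>
     (\<forall>w. rabin_accepting (dra_acc A) (dra_run A w) \<longleftrightarrow> ltl_sat w 0 \<phi>)"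


section \<open>Partially observable stochastic games and their products with Rabin automata\<close>

record ('s, 'ud, 'ua, 'od, 'oa) game =
  init :: 's
  tprob :: "'s \<Rightarrow> 'ud \<Rightarrow> 'ua \<Rightarrow> 's pmf"
  obs_d :: "'s \<Rightarrow> 'od pmf"
  obs_a :: "'s \<Rightarrow> 'oa pmf"

record ('s, 'ud, 'ua, 'od, 'oa, 'ap) posg = "('s, 'ud, 'ua, 'od, 'oa) game" +
  label :: "'s \<Rightarrow> 'ap set"

record ('s, 'ud, 'ua, 'od, 'oa) rabin_posg = "('s, 'ud, 'ua, 'od, 'oa) game" +
  acc :: "'s rabin_pairs"

definition product_tprob ::
  "('s::finite, 'ud, 'ua, 'od, 'oa, 'ap) posg \<Rightarrow> ('q::finite, 'ap set) dra \<Rightarrow>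
   's \<times> 'q \<Rightarrow> 'ud \<Rightarrow> 'ua \<Rightarrow> 's \<times> 'q \<Rightarrow> real" where
  "product_tprob SG A = (\<lambda>(s, q) ud ua (s', q').
     if dra_delta A q (label SG s') = q' then pmf (tprob SG s ud ua) s' else 0)"

definition product_posg ::
  "('s::finite, 'ud, 'ua, 'od, 'oa, 'ap) posg \<Rightarrow> ('q::finite, 'ap set) dra \<Rightarrow>
   ('s \<times> 'q, 'ud, 'ua, 'od, 'oa) rabin_posg" where
  "product_posg SG A =
     \<lparr> init = (init SG, dra_init A),
       tprob = (\<lambda>x ud ua. embed_pmf (product_tprob SG A x ud ua)),
       obs_d = (\<lambda>(s, q). obs_d SG s),
       obs_a = (\<lambda>(s, q). obs_a SG s),
       acc = (\<lambda>(L, K). ({(s, q). q \<in> L}, {(s, q). q \<in> K})) ` dra_acc A \<rparr>"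

text \<open>\<^const>\<open>embed_pmf\<close> is unspecified off probability mass functions; here it is applied to one.\<close>

lemma pmf_embed_pmf_finite:
  fixes f :: "'a::finite \<Rightarrow> real"
  assumes "\<And>x. 0 \<le> f x" "(\<Sum>x\<in>UNIV. f x) = 1"
  shows "pmf (embed_pmf f) x = f x"
  using assms by (intro pmf_embed_pmf) (auto simp: nn_integral_count_space_finite sum_ennreal)

lemma sum_pmf_UNIV: "(\<Sum>x\<in>UNIV. pmf (p :: 'a::finite pmf) x) = 1"
  by (simp add: sum_pmf_eq_1)

lemma pmf_product_tprob:
  fixes SG :: "('s::finite, 'ud, 'ua, 'od, 'oa, 'ap) posg" and A :: "('q::finite, 'ap set) dra"
  shows "pmf (tprob (product_posg SG A) x ud ua) y = product_tprob SG A x ud ua y"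
proof -
  obtain s q where x: "x = (s, q)" by force
  have "(\<Sum>y\<in>UNIV. product_tprob SG A x ud ua y) =
      (\<Sum>s'\<in>UNIV. \<Sum>q'\<in>UNIV. product_tprob SG A x ud ua (s', q'))"
    by (simp add: sum.cartesian_product)
  also have "\<dots> = (\<Sum>s'\<in>UNIV. pmf (tprob SG s ud ua) s')"
    by (simp add: product_tprob_def x)
  also have "\<dots> = 1" by (rule sum_pmf_UNIV)
  finally have "pmf (embed_pmf (product_tprob SG A x ud ua)) y = product_tprob SG A x ud ua y"
    by (intro pmf_embed_pmf_finite) (auto simp: product_tprob_def split: prod.splits)
  then show ?thesis by (simp add: product_posg_def)
qed


section \<open>Finite state controllers and the global Markov chain\<close>

record ('g, 'o, 'u) fsc =
  fsc_init :: 'g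
  fsc_mu :: "'g \<Rightarrow> 'o \<Rightarrow> ('g \<times> 'u) pmf"

definition gmc_tprob ::
  "('s::finite, 'ud::finite, 'ua::finite, 'od::finite, 'oa::finite) rabin_posg \<Rightarrow>
   ('gd::finite, 'od, 'ud) fsc \<Rightarrow> ('ga::finite, 'oa, 'ua) fsc \<Rightarrow>
   's \<times> 'gd \<times> 'ga \<Rightarrow> 's \<times> 'gd \<times> 'ga \<Rightarrow> real" where
  "gmc_tprob G Cd Ca = (\<lambda>(x, gd, ga) (x', gd', ga').
     \<Sum>od\<in>UNIV. \<Sum>oa\<in>UNIV. \<Sum>ud\<in>UNIV. \<Sum>ua\<in>UNIV.
       pmf (obs_d G x) od * pmf (obs_a G x) oa *
       pmf (fsc_mu Cd gd od) (gd', ud) * pmf (fsc_mu Ca ga oa) (ga', ua) *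
       pmf (tprob G x ud ua) x')"

definition gmc ::
  "('s::finite, 'ud::finite, 'ua::finite, 'od::finite, 'oa::finite) rabin_posg \<Rightarrow>
   ('gd::finite, 'od, 'ud) fsc \<Rightarrow> ('ga::finite, 'oa, 'ua) fsc \<Rightarrow>
   's \<times> 'gd \<times> 'ga \<Rightarrow> ('s \<times> 'gd \<times> 'ga) pmf" where
  "gmc G Cd Ca z = embed_pmf (gmc_tprob G Cd Ca z)"

definition gmc_init ::
  "('s, 'ud, 'ua, 'od, 'oa) rabin_posg \<Rightarrow> ('gd, 'od, 'ud) fsc \<Rightarrow> ('ga, 'oa, 'ua) fsc \<Rightarrow>
   's \<times> 'gd \<times> 'ga" where
  "gmc_init G Cd Ca = (init G, fsc_init Cd, fsc_init Ca)"

lemma pmf_gmc: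
  fixes G :: "('s::finite, 'ud::finite, 'ua::finite, 'od::finite, 'oa::finite) rabin_posg"
    and Cd :: "('gd::finite, 'od, 'ud) fsc" and Ca :: "('ga::finite, 'oa, 'ua) fsc"
  shows "pmf (gmc G Cd Ca z) z' = gmc_tprob G Cd Ca z z'"
  unfolding gmc_def
proof (rule pmf_embed_pmf_finite)
  obtain x gd ga where z: "z = (x, gd, ga)" by (cases z) auto
  show "0 \<le> gmc_tprob G Cd Ca z z''" for z''
    by (auto simp: gmc_tprob_def split: prod.splits intro!: sum_nonneg)
  define f where "f od oa gd' ud ga' ua x' =
       pmf (obs_d G x) od * pmf (obs_a G x) oa *
       pmf (fsc_mu Cd gd od) (gd', ud) * pmf (fsc_mu Ca ga oa) (ga', ua) *
       pmf (tprob G x ud ua) x'" for od oa gd' ud ga' ua x'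
  have "(\<Sum>z''\<in>UNIV. gmc_tprob G Cd Ca z z'') =
      (\<Sum>((x', gd', ga'), od, oa, ud, ua)\<in>UNIV. f od oa gd' ud ga' ua x')"
    by (simp add: gmc_tprob_def z f_def sum.cartesian_product case_prod_unfold)
  also have "\<dots> = (\<Sum>(od, oa, (gd', ud), (ga', ua), x')\<in>UNIV. f od oa gd' ud ga' ua x')"
    by (rule sum.reindex_bij_witness[where
          i = "\<lambda>(od, oa, (gd', ud), (ga', ua), x'). ((x', gd', ga'), od, oa, ud, ua)" and
          j = "\<lambda>((x', gd', ga'), od, oa, ud, ua). (od, oa, (gd', ud), (ga', ua), x')"]) auto
  also have "\<dots> = (\<Sum>od\<in>UNIV. \<Sum>oa\<in>UNIV. \<Sum>p\<in>UNIV. \<Sum>r\<in>UNIV. \<Sum>x'\<in>UNIV.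
      f od oa (fst p) (snd p) (fst r) (snd r) x')"
    by (simp add: sum.cartesian_product case_prod_unfold)
  also have "\<dots> = 1"
    by (simp add: f_def sum_pmf_UNIV flip: sum_distrib_left)
  finally show "(\<Sum>z''\<in>UNIV. gmc_tprob G Cd Ca z z'') = 1" .
qed


section \<open>Path measure of a Markov chain\<close>

text \<open>
  The Ionescu-Tulcea measure on infinite paths; coordinate \<open>0\<close> is the starting state.
  See \<open>path_measure_cylinder\<close> for the finite-dimensional distributions.
\<close>

definition mc_kernel :: "('s \<Rightarrow> 's pmf) \<Rightarrow> 's \<Rightarrow> nat \<Rightarrow> (nat \<Rightarrow> 's) \<Rightarrow> 's measure" where
  "mc_kernel K s n \<omega> = measure_pmf (case n of 0 \<Rightarrow> return_pmf s | Suc m \<Rightarrow> K (\<omega> m))"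

definition path_measure :: "('s \<Rightarrow> 's pmf) \<Rightarrow> 's \<Rightarrow> (nat \<Rightarrow> 's) measure" where
  "path_measure K s = projective_family.lim UNIV
     (Ionescu_Tulcea.CI (mc_kernel K s) (\<lambda>_. count_space UNIV)) (\<lambda>_. count_space UNIV)"

lemma Ionescu_Tulcea_mc_kernel: "Ionescu_Tulcea (mc_kernel K s) (\<lambda>_. count_space UNIV)"
proof (rule Ionescu_Tulcea.intro)
  have pmf: "measure_pmf p \<in> space (subprob_algebra (count_space UNIV))" for p :: "'a pmf"
    by (simp add: space_subprob_algebra prob_space_imp_subprob_space prob_space_measure_pmf)
  fix i
  show "mc_kernel K s i \<in> measurable (Pi\<^sub>M {0..<i} (\<lambda>_. count_space UNIV)) (subprob_algebra (count_space UNIV))"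
  proof (cases i)
    case 0
    have "mc_kernel K s i = (\<lambda>_. measure_pmf (return_pmf s))"
      by (simp add: mc_kernel_def[abs_def] 0)
    then show ?thesis
      using pmf by (simp only: measurable_const)
  next
    case (Suc n)
    have K: "(\<lambda>x. measure_pmf (K x)) \<in> measurable (count_space UNIV) (subprob_algebra (count_space UNIV))"
      using pmf by (simp only: measurable_count_space_eq1 Pi_iff) simp
    have c: "(\<lambda>\<omega>. \<omega> n) \<in> measurable (Pi\<^sub>M {0..<i} (\<lambda>_. count_space UNIV)) (count_space UNIV)"
      by (rule measurable_component_singleton) (simp add: Suc)
    have eq: "mc_kernel K s i = (\<lambda>\<omega>. measure_pmf (K (\<omega> n)))"
      by (simp add: mc_kernel_def[abs_def] Suc)
    show ?thesis unfolding eq by (rule measurable_compose[OF c K])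
  qed
qed (unfold mc_kernel_def, rule prob_space_measure_pmf)

lemma sets_path_measure: "sets (path_measure K s) = sets (Pi\<^sub>M UNIV (\<lambda>_. count_space UNIV))"
proof -
  interpret Ionescu_Tulcea "mc_kernel K s" "\<lambda>_. count_space UNIV"
    by (rule Ionescu_Tulcea_mc_kernel)
  show ?thesis by (simp add: path_measure_def)
qed

lemma space_path_measure: "space (path_measure K s) = UNIV"
  using sets_eq_imp_space_eq[OF sets_path_measure, of K s] by (simp add: space_PiM)

lemma path_measure_cylinder:
  "measure (path_measure K s) {\<pi>. \<forall>i\<le>n. \<pi> i = x i} =
     (if x 0 = s then \<Prod>i<n. pmf (K (x i)) (x (Suc i)) else 0)"
proof -
  interpret Ionescu_Tulcea "mc_kernel K s" "\<lambda>_. count_space UNIV"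
    by (rule Ionescu_Tulcea_mc_kernel)
  let ?M = "\<lambda>_::nat. count_space (UNIV :: 'a set)"
  let ?r = "\<lambda>m. restrict x {0..<m}"
  have single: "{?r m} = Pi\<^sub>E {0..<m} (\<lambda>i. {x i})" for m
  proof -
    have "{?r m} = Pi\<^sub>E {0..<m} (\<lambda>i. {?r m i})" by (rule PiE_singleton[symmetric]) simp
    also have "\<dots> = Pi\<^sub>E {0..<m} (\<lambda>i. {x i})" by (rule PiE_cong) simp
    finally show ?thesis .
  qed
  have sets[measurable]: "{?r m} \<in> sets (Pi\<^sub>M {0..<m} ?M)" for m
    unfolding single by (intro sets_PiM_I_finite) auto
  have C: "emeasure (C 0 m (\<lambda>_. undefined)) {?r m} =
      (\<Prod>i<m. emeasure (mc_kernel K s i x) {x i})" for m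
  proof (induction m)
    case 0
    have "?r 0 = (\<lambda>_. undefined)" by auto
    then show ?case using emeasure_return[OF sets[of 0], of "\<lambda>_. undefined"] by simp
  next
    case (Suc m)
    have [simp]: "(\<lambda>_. undefined) \<in> space (Pi\<^sub>M {0..<0} ?M)" by (simp add: space_PiM)
    have "emeasure (C 0 (Suc m) (\<lambda>_. undefined)) {?r (Suc m)} =
        (\<integral>\<^sup>+\<omega>. emeasure (eP m \<omega>) {?r (Suc m)} \<partial>C 0 m (\<lambda>_. undefined))"
    proof -
      have "eP m \<in> measurable (C 0 m (\<lambda>_. undefined)) (subprob_algebra (Pi\<^sub>M {0..<Suc m} ?M))"
      proof -
        have "measurable (C 0 m (\<lambda>_. undefined)) N = measurable (Pi\<^sub>M {0..<m} ?M) N" for N :: "(nat \<Rightarrow> 'a) measure measure"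
          using sets_C[of "\<lambda>_. undefined" 0 m] by (intro measurable_cong_sets) simp_all
        from this[of "subprob_algebra (Pi\<^sub>M {0..<Suc m} ?M)"] show ?thesis by (simp only: measurable_eP)
      qed
      moreover have "space (C 0 m (\<lambda>_. undefined)) \<noteq> {}"
        by (rule prob_space.not_empty[OF prob_space_C]) simp
      ultimately show ?thesis
        using emeasure_bind[OF _ _ sets[of "Suc m"]] by simp
    qed
    also have "\<dots> = (\<integral>\<^sup>+\<omega>. emeasure (mc_kernel K s m x) {x m} * indicator {?r m} \<omega> \<partial>C 0 m (\<lambda>_. undefined))"
    proof (rule nn_integral_cong)
      fix \<omega> assume "\<omega> \<in> space (C 0 m (\<lambda>_. undefined))"
      then have \<omega>: "\<omega> \<in> space (Pi\<^sub>M {0..<m} ?M)" by (simp add: space_C)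
      then have extl: "\<omega> \<in> extensional {0..<m}" by (simp add: space_PiM PiE_def)
      have upd: "fun_upd \<omega> m y = ?r (Suc m) \<longleftrightarrow> \<omega> = ?r m \<and> y = x m" for y
      proof
        assume a: "fun_upd \<omega> m y = ?r (Suc m)"
        have "y = x m" using fun_cong[OF a, of m] by simp
        moreover have "\<omega> i = ?r m i" for i
          using fun_cong[OF a, of i] extl by (cases "i = m") (auto simp: extensional_def)
        ultimately show "\<omega> = ?r m \<and> y = x m" by auto
      next
        assume "\<omega> = ?r m \<and> y = x m"
        then show "fun_upd \<omega> m y = ?r (Suc m)"
          by (intro ext) (auto simp: restrict_def)
      qed
      have k: "mc_kernel K s m (?r m) = mc_kernel K s m x"
        by (cases m) (auto simp: mc_kernel_def)
      have v: "(\<lambda>y. fun_upd \<omega> m y) -` {?r (Suc m)} = (if \<omega> = ?r m then {x m} else {})"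
        by (rule set_eqI) (unfold vimage_eq singleton_iff upd, simp)
      show "emeasure (eP m \<omega>) {?r (Suc m)} = emeasure (mc_kernel K s m x) {x m} * indicator {?r m} \<omega>"
        unfolding emeasure_eP[OF \<omega> sets] v using k by (cases "\<omega> = ?r m") auto
    qed
    also have "\<dots> = emeasure (mc_kernel K s m x) {x m} * emeasure (C 0 m (\<lambda>_. undefined)) {?r m}"
      by (intro nn_integral_cmult_indicator) (simp add: sets_C)
    finally show ?case by (simp only: Suc prod.lessThan_Suc mult.commute)
  qed
  have emb: "{\<pi>. \<forall>i\<le>n. \<pi> i = x i} = prod_emb UNIV ?M {0..<Suc n} {?r (Suc n)}"
  proof -
    have "(\<forall>i\<le>n. \<pi> i = x i) \<longleftrightarrow> restrict \<pi> {0..<Suc n} = ?r (Suc n)" for \<pi> :: "nat \<Rightarrow> 'a"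
    proof
      assume "\<forall>i\<le>n. \<pi> i = x i"
      then show "restrict \<pi> {0..<Suc n} = ?r (Suc n)" by (intro restrict_ext) auto
    next
      assume a: "restrict \<pi> {0..<Suc n} = ?r (Suc n)"
      show "\<forall>i\<le>n. \<pi> i = x i"
      proof (intro allI impI)
        fix i assume "i \<le> n"
        then show "\<pi> i = x i" using fun_cong[OF a, of i] by simp
      qed
    qed
    then show ?thesis by (simp add: prod_emb_def space_PiM vimage_def)
  qed
  have "emeasure (path_measure K s) {\<pi>. \<forall>i\<le>n. \<pi> i = x i} = emeasure (CI {0..<Suc n}) {?r (Suc n)}"
    unfolding emb path_measure_def by (rule lim) auto
  also have "\<dots> = emeasure (C 0 (Suc n) (\<lambda>_. undefined)) (prod_emb {0..<Suc n} ?M {0..<Suc n} {?r (Suc n)})"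
    by (rule emeasure_CI) auto
  also have "prod_emb {0..<Suc n} ?M {0..<Suc n} {?r (Suc n)} = {?r (Suc n)}"
    by (rule prod_emb_id) (auto simp: space_PiM)
  also have "emeasure (C 0 (Suc n) (\<lambda>_. undefined)) {?r (Suc n)} =
      emeasure (mc_kernel K s 0 x) {x 0} * (\<Prod>i<n. emeasure (mc_kernel K s (Suc i) x) {x (Suc i)})"
    by (simp only: C prod.lessThan_Suc_shift)
  also have "\<dots> = ennreal (if x 0 = s then \<Prod>i<n. pmf (K (x i)) (x (Suc i)) else 0)"
    by (auto simp: mc_kernel_def emeasure_pmf_single prod_ennreal indicator_def)
  finally show ?thesis
    by (simp add: measure_def prod_nonneg)
qed


section \<open>Recurrence classes, feasibility and satisfaction probability\<close>

definition mc_recurrent :: "('s \<Rightarrow> 's pmf) \<Rightarrow> 's \<Rightarrow> bool" where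
  "mc_recurrent K x \<longleftrightarrow> measure (path_measure K x) {\<pi>. \<exists>n>0. \<pi> n = x} = 1"

definition mc_accessible :: "('s \<Rightarrow> 's pmf) \<Rightarrow> 's \<Rightarrow> 's \<Rightarrow> bool" where
  "mc_accessible K x y \<longleftrightarrow> (\<exists>n. measure (path_measure K x) {\<pi>. \<pi> n = y} > 0)"

definition mc_communicating :: "('s \<Rightarrow> 's pmf) \<Rightarrow> 's \<Rightarrow> 's \<Rightarrow> bool" where
  "mc_communicating K x y \<longleftrightarrow> mc_accessible K x y \<and> mc_accessible K y x"

definition recurrence_classes :: "('s \<Rightarrow> 's pmf) \<Rightarrow> 's set set" where
  "recurrence_classes K =
     {x. mc_recurrent K x} //
     {(x, y). mc_recurrent K x \<and> mc_recurrent K y \<and> mc_communicating K x y}"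

definition feasible :: "'s rabin_pairs \<Rightarrow> ('s \<times> 'gd \<times> 'ga) set \<Rightarrow> bool" where
  "feasible F R \<longleftrightarrow> (\<exists>(L, K) \<in> F. K \<inter> fst ` R \<noteq> {} \<and> L \<inter> fst ` R = {})"

definition feasible_rec_sets ::
  "('s::finite, 'ud::finite, 'ua::finite, 'od::finite, 'oa::finite) rabin_posg \<Rightarrow>
   ('gd::finite, 'od, 'ud) fsc \<Rightarrow> ('ga::finite, 'oa, 'ua) fsc \<Rightarrow> ('s \<times> 'gd \<times> 'ga) set set" where
  "feasible_rec_sets G Cd Ca = {R \<in> recurrence_classes (gmc G Cd Ca). feasible (acc G) R}"

definition gmc_paths ::
  "('s::finite, 'ud::finite, 'ua::finite, 'od::finite, 'oa::finite) rabin_posg \<Rightarrow>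
   ('gd::finite, 'od, 'ud) fsc \<Rightarrow> ('ga::finite, 'oa, 'ua) fsc \<Rightarrow>
   (nat \<Rightarrow> 's \<times> 'gd \<times> 'ga) measure" where
  "gmc_paths G Cd Ca = path_measure (gmc G Cd Ca) (gmc_init G Cd Ca)"

definition sat_prob ::
  "('s::finite, 'ud::finite, 'ua::finite, 'od::finite, 'oa::finite) rabin_posg \<Rightarrow>
   ('gd::finite, 'od, 'ud) fsc \<Rightarrow> ('ga::finite, 'oa, 'ua) fsc \<Rightarrow> real" where
  "sat_prob G Cd Ca = measure (gmc_paths G Cd Ca) {\<pi>. rabin_accepting (acc G) (\<lambda>n. fst (\<pi> n))}"

definition reach_prob ::
  "('s::finite, 'ud::finite, 'ua::finite, 'od::finite, 'oa::finite) rabin_posg \<Rightarrow>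
   ('gd::finite, 'od, 'ud) fsc \<Rightarrow> ('ga::finite, 'oa, 'ua) fsc \<Rightarrow> ('s \<times> 'gd \<times> 'ga) set \<Rightarrow> real" where
  "reach_prob G Cd Ca R = measure (gmc_paths G Cd Ca) {\<pi>. \<exists>n. \<pi> n \<in> R}"

text \<open>
  \<^const>\<open>measure\<close> is \<open>0\<close> off the measurable sets; the events above are measurable.
\<close>

lemma sets_visit: "{\<pi>. \<pi> n \<in> B} \<in> sets (path_measure K s)"
proof -
  have "(\<lambda>\<pi>. \<pi> n) \<in> measurable (Pi\<^sub>M UNIV (\<lambda>_. count_space UNIV)) (count_space UNIV)"
    by (rule measurable_component_singleton) simp
  from measurable_sets[OF this, of B] show ?thesis
    by (simp add: sets_path_measure space_PiM vimage_def)
qed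

lemma sets_reach: "{\<pi>. \<exists>n. \<pi> n \<in> B} \<in> sets (path_measure K s)"
proof -
  have "{\<pi>. \<exists>n. \<pi> n \<in> B} = (\<Union>n. {\<pi>. \<pi> n \<in> B})" by auto
  also have "\<dots> \<in> sets (path_measure K s)" by (intro sets.countable_UN'' sets_visit) auto
  finally show ?thesis .
qed

lemma sets_return: "{\<pi>. \<exists>n>0. \<pi> n = x} \<in> sets (path_measure K s)"
proof -
  have "{\<pi>. \<exists>n>0. \<pi> n = x} = (\<Union>n\<in>{0<..}. {\<pi>. \<pi> n \<in> {x}})" by auto
  also have "\<dots> \<in> sets (path_measure K s)" by (intro sets.countable_UN'' sets_visit) auto
  finally show ?thesis .
qed

lemma sets_infinitely_often: "{\<pi>. infinite {n. \<pi> n \<in> B}} \<in> sets (path_measure K s)"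
proof -
  have iff: "infinite {n. \<pi> n \<in> B} \<longleftrightarrow> (\<forall>m. \<exists>n\<in>{m..}. \<pi> n \<in> B)" for \<pi> :: "nat \<Rightarrow> 'a"
    unfolding infinite_nat_iff_unbounded_le by blast
  have "{\<pi>. infinite {n. \<pi> n \<in> B}} = {\<pi> :: nat \<Rightarrow> 'a. \<forall>m. \<exists>n\<in>{m..}. \<pi> n \<in> B}"
    by (rule Collect_cong) (rule iff)
  also have "\<dots> = (\<Inter>m. \<Union>n\<in>{m..}. {\<pi>. \<pi> n \<in> B})"
    by auto
  also have "\<dots> \<in> sets (path_measure K s)"
    using sets.top[of "path_measure K s"] unfolding space_path_measure
    by (intro sets.countable_INT'' sets.countable_UN'' sets_visit) auto
  finally show ?thesis .
qed

lemma sets_rabin_accepting: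
  fixes F :: "('s::finite) rabin_pairs"
  shows "{\<pi>. rabin_accepting F (\<lambda>n. fst (\<pi> n))} \<in> sets (path_measure K (s :: 's \<times> 'b))"
proof -
  have inf: "{\<pi>. infinite {n. fst (\<pi> n) \<in> B}} \<in> sets (path_measure K s)" for B :: "'s set"
    using sets_infinitely_often[of "fst -` B" K s] by simp
  have "{\<pi>. rabin_accepting F (\<lambda>n. fst (\<pi> n))} =
      (\<Union>(L, K)\<in>F. (UNIV - {\<pi>. infinite {n. fst (\<pi> n) \<in> L}}) \<inter> {\<pi>. infinite {n. fst (\<pi> n) \<in> K}})"
    by (auto simp: rabin_accepting_def)
  also have "\<dots> \<in> sets (path_measure K s)"
    using inf sets.top[of "path_measure K s"] unfolding space_path_measure
    by (intro sets.countable_UN'') (auto intro!: sets.Diff sets.Int countable_finite)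
  finally show ?thesis .
qed

end

theory Submission
  imports Defs
begin

text \<open>
  In a finite Markov chain almost every path satisfies: if \<open>x\<close> is visited infinitely often and \<open>y\<close>
  is reachable from \<open>x\<close> in the transition graph, then \<open>y\<close> is visited infinitely often. Hence the
  states visited infinitely often form a single bottom strongly connected component, that is, a
  recurrence class, and the path reaches no other class because classes cannot be left. Such a
  path is accepting iff its limit class is feasible.
\<close>

section \<open>First-step analysis of the path measure\<close>

abbreviation path_space :: "(nat \<Rightarrow> 's) measure" where
  "path_space \<equiv> Pi\<^sub>M UNIV (\<lambda>_. count_space UNIV)"

declare sets_path_measure [measurable_cong]

lemma space_path_space [simp]: "space path_space = UNIV"
  by (simp add: space_PiM)

lemma measurable_nth [measurable]: "(\<lambda>\<pi>. \<pi> n) \<in> measurable path_space (count_space UNIV)"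
  by (rule measurable_component_singleton) simp

text \<open>The total mass is read off the projective limit at the empty index set, whose cylinder
  is the whole path space.\<close>

lemma prob_space_path_measure: "prob_space (path_measure K s)"
proof -
  interpret Ionescu_Tulcea "mc_kernel K s" "\<lambda>_. count_space UNIV"
    by (rule Ionescu_Tulcea_mc_kernel)
  let ?M = "\<lambda>_::nat. count_space (UNIV :: 'a set)"
  have "emeasure (path_measure K s) (prod_emb UNIV ?M {} (space (Pi\<^sub>M {} ?M))) =
      emeasure (CI {}) (space (Pi\<^sub>M {} ?M))"
    unfolding path_measure_def by (rule lim) auto
  also have "space (Pi\<^sub>M {} ?M) = space (CI {})"
    by (simp add: PF.space_P)
  also have "emeasure (CI {}) (space (CI {})) = 1"
    by (intro prob_space.emeasure_space_1 PF.prob_space_P) auto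
  finally show ?thesis
    by (intro prob_spaceI) (simp add: space_path_measure prod_emb_def space_PiM PF.space_P restrict_def vimage_def)
qed

lemma measurable_case_nat_path [measurable]:
  "case_nat s \<in> measurable path_space path_space"
proof (rule measurable_PiM_single')
  fix i :: nat
  show "(\<lambda>\<omega>. case_nat s \<omega> i) \<in> measurable path_space (count_space UNIV)"
    by (cases i) simp_all
qed simp

lemma measurable_shift_path [measurable]:
  "(\<lambda>\<omega> k. \<omega> (k + n)) \<in> measurable path_space path_space"
  by (rule measurable_PiM_single') simp_all

text \<open>Events constraining finitely many coordinates generate the product sigma-algebra. With
  finitely many states, each such product event is a finite disjoint union of cylinders that fix an
  initial segment.\<close>

lemma path_measure_eqI_cylinder:
  fixes M N :: "(nat \<Rightarrow> 's::finite) measure"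
  assumes "prob_space M" "prob_space N" "sets M = sets path_space" "sets N = sets path_space"
    and cyl: "\<And>n x. measure M {\<pi>. \<forall>i\<le>n. \<pi> i = x i} = measure N {\<pi>. \<forall>i\<le>n. \<pi> i = x i}"
  shows "M = N"
proof (rule measure_eqI_PiM_infinite)
  interpret M: prob_space M by fact
  interpret N: prob_space N by fact
  show "finite_measure M" by (rule M.finite_measure_axioms)
  fix A :: "nat \<Rightarrow> 's set" and J :: "nat set"
  assume J: "finite J"
  let ?X = "prod_emb UNIV (\<lambda>_. count_space UNIV) J (Pi\<^sub>E J A)"
  \<comment> \<open>Inserting 0 keeps \<open>Max\<close> meaningful when \<open>J\<close> is
    empty.\<close>
  define n where "n = Max (insert 0 J)"
  have n: "j \<le> n" if "j \<in> J" for j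
    using J that by (simp add: n_def)
  \<comment> \<open>The initial segments compatible with \<open>A\<close>, taken extensional so that
    distinct ones differ at some index up to \<open>n\<close> and hence have disjoint
    cylinders.\<close>
  define Y where "Y = Pi\<^sub>E {..n} (\<lambda>i. if i \<in> J then A i else UNIV)"
  define C where "C x = {\<pi> :: nat \<Rightarrow> 's. \<forall>i\<le>n. \<pi> i = x i}" for x
  have finY: "finite Y"
    unfolding Y_def by (rule finite_PiE) auto
  have X: "?X = (\<Union>x\<in>Y. C x)"
  proof (rule set_eqI)
    fix \<pi> :: "nat \<Rightarrow> 's"
    have "\<pi> \<in> ?X \<longleftrightarrow> (\<forall>j\<in>J. \<pi> j \<in> A j)"
      by (auto simp: prod_emb_def space_PiM PiE_iff)
    also have "\<dots> \<longleftrightarrow> restrict \<pi> {..n} \<in> Y"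
      using n by (auto simp: Y_def PiE_iff)
    also have "\<dots> \<longleftrightarrow> (\<exists>x\<in>Y. \<pi> \<in> C x)"
    proof
      assume "\<exists>x\<in>Y. \<pi> \<in> C x"
      then obtain x where x: "x \<in> Y" "\<pi> \<in> C x" by blast
      have "restrict \<pi> {..n} = x"
        using x by (intro ext) (auto simp: C_def Y_def PiE_def extensional_def)
      with x show "restrict \<pi> {..n} \<in> Y" by simp
    next
      assume "restrict \<pi> {..n} \<in> Y"
      moreover have "\<pi> \<in> C (restrict \<pi> {..n})" by (simp add: C_def)
      ultimately show "\<exists>x\<in>Y. \<pi> \<in> C x" by blast
    qed
    finally show "\<pi> \<in> ?X \<longleftrightarrow> \<pi> \<in> (\<Union>x\<in>Y. C x)" by simp
  qed
  have disj: "disjoint_family_on C Y"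
    unfolding disjoint_family_on_def
  proof (intro ballI impI)
    fix x y assume "x \<in> Y" "y \<in> Y" "x \<noteq> y"
    then obtain i where "i \<in> {..n}" "x i \<noteq> y i"
      using PiE_ext[of x "{..n}" _ y] unfolding Y_def by metis
    then show "C x \<inter> C y = {}" by (auto simp: C_def)
  qed
  have C: "C x \<in> sets path_space" for x
  proof -
    have "Measurable.pred path_space (\<lambda>\<pi>. \<forall>i\<le>n. \<pi> i = x i)" by measurable
    then show ?thesis by (simp add: C_def pred_def)
  qed
  have "measure M ?X = (\<Sum>x\<in>Y. measure M (C x))"
    unfolding X using C assms by (intro M.finite_measure_finite_Union finY disj) auto
  also have "\<dots> = (\<Sum>x\<in>Y. measure N (C x))"
    by (simp add: C_def cyl)
  also have "\<dots> = measure N ?X"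
    unfolding X using C assms by (intro N.finite_measure_finite_Union[symmetric] finY disj) auto
  finally show "emeasure M ?X = emeasure N ?X"
    by (simp add: M.emeasure_eq_measure N.emeasure_eq_measure)
qed (use assms in auto)

lemma measurable_path_kernel [measurable]:
  "(\<lambda>z. distr (path_measure K z) path_space (case_nat s))
     \<in> measurable (measure_pmf p) (subprob_algebra path_space)"
proof -
  have "prob_space (distr (path_measure K z) path_space (case_nat s))" for z
    by (intro prob_space.prob_space_distr prob_space_path_measure) measurable
  then show ?thesis
    by (simp add: space_subprob_algebra prob_space_imp_subprob_space)
qed

text \<open>The Markov property at time one. On a cylinder both sides give the same product:
  averaging over \<open>z\<close> keeps only \<open>z = x 1\<close>, which supplies the first
  factor, and the path from \<open>z\<close> supplies the others.\<close>

lemma path_measure_first_step: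
  fixes K :: "'s::finite \<Rightarrow> 's pmf"
  shows "path_measure K s =
    measure_pmf (K s) \<bind> (\<lambda>z. distr (path_measure K z) path_space (case_nat s))"
    (is "_ = ?N")
proof (rule path_measure_eqI_cylinder)
  show "prob_space (path_measure K s)" by (rule prob_space_path_measure)
  show "prob_space ?N"
    by (intro measure_pmf.prob_space_bind measurable_path_kernel AE_I2
        prob_space.prob_space_distr prob_space_path_measure) measurable
  show "sets (path_measure K s) = sets path_space" by (rule sets_path_measure)
  show "sets ?N = sets path_space" by (rule sets_bind) auto
  fix n :: nat and x :: "nat \<Rightarrow> 's"
  let ?C = "{\<pi>. \<forall>i\<le>n. \<pi> i = x i}"
  have C: "?C \<in> sets path_space"
  proof -
    have "Measurable.pred path_space (\<lambda>\<pi>. \<forall>i\<le>n. \<pi> i = x i)" by measurable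
    then show ?thesis by (simp add: pred_def)
  qed
  \<comment> \<open>Prepending \<open>s\<close> uses up the constraint at index 0 and shifts the
    others down by one; for \<open>n = 0\<close> nothing is left to constrain
    \<open>z\<close>.\<close>
  have step: "measure (distr (path_measure K z) path_space (case_nat s)) ?C =
      (if x 0 = s then case n of 0 \<Rightarrow> 1 | Suc m \<Rightarrow>
         if x 1 = z then \<Prod>i<m. pmf (K (x (Suc i))) (x (Suc (Suc i))) else 0 else 0)" for z
  proof -
    interpret Z: prob_space "path_measure K z" by (rule prob_space_path_measure)
    have "measure (distr (path_measure K z) path_space (case_nat s)) ?C =
        measure (path_measure K z) {\<omega>. \<forall>i\<le>n. case_nat s \<omega> i = x i}"
      using C by (subst measure_distr) (auto simp: space_path_measure vimage_def)
    also have "{\<omega>. \<forall>i\<le>n. case_nat s \<omega> i = x i} =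
        (if x 0 = s then case n of 0 \<Rightarrow> UNIV | Suc m \<Rightarrow> {\<omega>. \<forall>i\<le>m. \<omega> i = x (Suc i)} else {})"
      by (auto split: nat.splits)
    finally show ?thesis
      using Z.prob_space by (simp add: path_measure_cylinder space_path_measure split: nat.split)
  qed
  have "measure ?N ?C =
      (\<integral>z. measure (distr (path_measure K z) path_space (case_nat s)) ?C \<partial>measure_pmf (K s))"
    by (rule measure_pmf.measure_bind[OF measurable_path_kernel C])
  also have "\<dots> = (\<Sum>z\<in>UNIV. pmf (K s) z *
      measure (distr (path_measure K z) path_space (case_nat s)) ?C)"
    by (subst integral_measure_pmf[of UNIV]) auto
  also have "\<dots> = measure (path_measure K s) ?C"
    unfolding step path_measure_cylinder
    by (cases n; cases "x 0 = s")
      (simp_all add: sum_pmf_UNIV prod.lessThan_Suc_shift mult_delta_right del: prod.lessThan_Suc)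
  finally show "measure (path_measure K s) ?C = measure ?N ?C" ..
qed

lemma measure_path_first_step:
  fixes K :: "'s::finite \<Rightarrow> 's pmf"
  assumes [measurable]: "Measurable.pred path_space P"
  shows "measure (path_measure K s) {\<pi>. P \<pi>} =
    (\<Sum>z\<in>UNIV. pmf (K s) z * measure (path_measure K z) {\<omega>. P (case_nat s \<omega>)})"
proof -
  have sets: "{\<pi>. P \<pi>} \<in> sets path_space"
    using assms by (simp add: pred_def)
  have "measure (path_measure K s) {\<pi>. P \<pi>} =
      (\<integral>z. measure (distr (path_measure K z) path_space (case_nat s)) {\<pi>. P \<pi>} \<partial>measure_pmf (K s))"
    by (subst path_measure_first_step) (rule measure_pmf.measure_bind[OF measurable_path_kernel sets])
  also have "\<dots> = (\<Sum>z\<in>UNIV. pmf (K s) z *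
      measure (distr (path_measure K z) path_space (case_nat s)) {\<pi>. P \<pi>})"
    by (subst integral_measure_pmf[of UNIV]) auto
  finally show ?thesis
    using sets by (simp add: measure_distr space_path_measure vimage_def)
qed

section \<open>Almost sure properties of paths\<close>

lemma AE_path_first_step:
  fixes K :: "'s::finite \<Rightarrow> 's pmf"
  assumes P: "Measurable.pred path_space P"
  shows "(AE \<pi> in path_measure K s. P \<pi>) \<longleftrightarrow>
    (\<forall>z\<in>set_pmf (K s). AE \<omega> in path_measure K z. P (case_nat s \<omega>))"
proof -
  have sets: "{\<omega> \<in> space path_space. P \<omega>} \<in> sets path_space"
    using P by (simp only: pred_def)
  have case_nat: "case_nat s \<in> measurable (path_measure K z) path_space" for z
    by measurable
  have "(AE \<pi> in path_measure K s. P \<pi>) \<longleftrightarrow>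
      (AE z in measure_pmf (K s). AE \<pi> in distr (path_measure K z) path_space (case_nat s). P \<pi>)"
    by (subst path_measure_first_step) (rule AE_bind[OF measurable_path_kernel P])
  then show ?thesis
    unfolding AE_distr_iff[OF case_nat sets] AE_measure_pmf_iff .
qed

text \<open>Substitute for the Markov property at time \<open>n\<close>: a property that is almost
  sure from every start survives dropping a prefix. Each first step changes the start, so the
  induction keeps \<open>s\<close> arbitrary.\<close>

lemma AE_path_shift:
  fixes K :: "'s::finite \<Rightarrow> 's pmf"
  assumes P: "Measurable.pred path_space P"
    and AE: "\<And>z. AE \<omega> in path_measure K z. P \<omega>"
  shows "AE \<omega> in path_measure K s. P (\<lambda>k. \<omega> (k + n))"
proof (induction n arbitrary: s)
  case 0
  show ?case by (simp add: AE)
next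
  case (Suc n)
  have "Measurable.pred path_space (\<lambda>\<omega>. P (\<lambda>k. \<omega> (k + Suc n)))"
    by (rule measurable_compose[OF measurable_shift_path P])
  from AE_path_first_step[OF this] show ?case
    by (simp add: Suc)
qed

lemma AE_path_start:
  fixes K :: "'s::finite \<Rightarrow> 's pmf"
  shows "AE \<pi> in path_measure K s. \<pi> 0 = s"
proof -
  have "Measurable.pred path_space (\<lambda>\<pi>. \<pi> 0 = s)" by measurable
  from AE_path_first_step[OF this] show ?thesis by simp
qed

lemma AE_path_edges:
  fixes K :: "'s::finite \<Rightarrow> 's pmf"
  shows "AE \<pi> in path_measure K s. \<forall>n. \<pi> (Suc n) \<in> set_pmf (K (\<pi> n))"
proof -
  \<comment> \<open>Naming the two coordinates by quantifiers over the finite state type reduces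
    measurability to that of single coordinates.\<close>
  have "(\<lambda>\<pi> :: nat \<Rightarrow> 's. \<pi> 1 \<in> set_pmf (K (\<pi> 0))) =
      (\<lambda>\<pi>. \<exists>a b. \<pi> 0 = a \<and> \<pi> 1 = b \<and> b \<in> set_pmf (K a))"
    by blast
  moreover have "Measurable.pred path_space \<dots>"
    by measurable
  ultimately have edge: "Measurable.pred path_space (\<lambda>\<pi>. \<pi> 1 \<in> set_pmf (K (\<pi> 0)))"
    by (simp only:)
  have "AE \<omega> in path_measure K z'. \<omega> 0 \<in> set_pmf (K z)" if "z' \<in> set_pmf (K z)" for z z'
    using AE_path_start[where K = K and s = z'] by eventually_elim (simp only: that)
  then have "AE \<pi> in path_measure K z. \<pi> 1 \<in> set_pmf (K (\<pi> 0))" for z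
    by (subst AE_path_first_step[OF edge]) simp
  \<comment> \<open>The indices \<open>1 + n\<close> and \<open>0 + n\<close> match the shift
    pattern \<open>k + n\<close> of \<open>AE_path_shift\<close>.\<close>
  then have "AE \<pi> in path_measure K s. \<pi> (1 + n) \<in> set_pmf (K (\<pi> (0 + n)))" for n
    by (rule AE_path_shift[OF edge])
  then show ?thesis
    by (simp add: AE_all_countable)
qed

lemma
  assumes "Measurable.pred path_space P"
  shows measure_path_eq_0_iff:
      "measure (path_measure K s) {\<pi>. P \<pi>} = 0 \<longleftrightarrow> (AE \<pi> in path_measure K s. \<not> P \<pi>)"
    and measure_path_eq_1_iff:
      "measure (path_measure K s) {\<pi>. P \<pi>} = 1 \<longleftrightarrow> (AE \<pi> in path_measure K s. P \<pi>)"
proof -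
  interpret prob_space "path_measure K s" by (rule prob_space_path_measure)
  have "{\<pi> \<in> space (path_measure K s). P \<pi>} \<in> sets (path_measure K s)"
    using assms by (simp add: pred_def sets_path_measure space_path_measure)
  from prob_Collect_eq_0[OF this] prob_Collect_eq_1[OF this]
  show "measure (path_measure K s) {\<pi>. P \<pi>} = 0 \<longleftrightarrow> (AE \<pi> in path_measure K s. \<not> P \<pi>)"
    "measure (path_measure K s) {\<pi>. P \<pi>} = 1 \<longleftrightarrow> (AE \<pi> in path_measure K s. P \<pi>)"
    by (simp_all add: space_path_measure)
qed

section \<open>Reachability and recurrence in finite chains\<close>

abbreviation mc_edges :: "('s \<Rightarrow> 's pmf) \<Rightarrow> ('s \<times> 's) set" where
  "mc_edges K \<equiv> {(x, y). y \<in> set_pmf (K x)}"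

lemma AE_path_reachable:
  fixes K :: "'s::finite \<Rightarrow> 's pmf"
  shows "AE \<pi> in path_measure K s. \<forall>m n. m \<le> n \<longrightarrow> (\<pi> m, \<pi> n) \<in> (mc_edges K)\<^sup>*"
  using AE_path_edges
proof eventually_elim
  case (elim \<pi>)
  have "(\<pi> m, \<pi> n) \<in> (mc_edges K)\<^sup>*" if "m \<le> n" for m n
    using that by (induction n rule: dec_induct) (use elim in \<open>auto intro: rtrancl_into_rtrancl\<close>)
  then show ?case by blast
qed

lemma AE_path_visits_reachable:
  fixes K :: "'s::finite \<Rightarrow> 's pmf"
  shows "AE \<pi> in path_measure K s. \<forall>n. (s, \<pi> n) \<in> (mc_edges K)\<^sup>*"
  using AE_path_reachable AE_path_start by eventually_elim auto

text \<open>Turns accessibility into a graph property. Almost every path follows edges, so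
  unreachable states have probability zero at every time; conversely, each edge of a walk multiplies
  the lower bound by a positive factor.\<close>

lemma mc_accessible_iff:
  fixes K :: "'s::finite \<Rightarrow> 's pmf"
  shows "mc_accessible K x y \<longleftrightarrow> (x, y) \<in> (mc_edges K)\<^sup>*"
proof
  assume "mc_accessible K x y"
  then obtain n where n: "measure (path_measure K x) {\<pi>. \<pi> n = y} > 0"
    by (auto simp: mc_accessible_def)
  have "Measurable.pred path_space (\<lambda>\<pi>. \<pi> n = y)" by measurable
  from measure_path_eq_0_iff[OF this] n have "\<not> (AE \<pi> in path_measure K x. \<pi> n \<noteq> y)"
    by (metis less_irrefl)
  then show "(x, y) \<in> (mc_edges K)\<^sup>*"
  proof (rule contrapos_np)
    assume "(x, y) \<notin> (mc_edges K)\<^sup>*"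
    then show "AE \<pi> in path_measure K x. \<pi> n \<noteq> y"
      using AE_path_visits_reachable[where K = K and s = x] by (auto elim: eventually_mono)
  qed
next
  assume "(x, y) \<in> (mc_edges K)\<^sup>*"
  then show "mc_accessible K x y"
  proof (induction rule: converse_rtrancl_induct)
    case base
    have "Measurable.pred path_space (\<lambda>\<pi>. \<pi> 0 = y)" by measurable
    from measure_path_eq_1_iff[OF this]
    have "measure (path_measure K y) {\<pi>. \<pi> 0 = y} = 1"
      using AE_path_start by blast
    then show ?case
      unfolding mc_accessible_def by (intro exI[of _ 0]) simp
  next
    case (step x z)
    then obtain n where n: "measure (path_measure K z) {\<pi>. \<pi> n = y} > 0"
      by (auto simp: mc_accessible_def)
    have "0 < pmf (K x) z * measure (path_measure K z) {\<pi>. \<pi> n = y}"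
      using step n by (simp add: pmf_positive)
    also have "\<dots> \<le> (\<Sum>z\<in>UNIV. pmf (K x) z * measure (path_measure K z) {\<pi>. \<pi> n = y})"
      by (rule member_le_sum) auto
    also have "\<dots> = measure (path_measure K x) {\<pi>. \<pi> (Suc n) = y}"
    proof -
      have "Measurable.pred path_space (\<lambda>\<pi>. \<pi> (Suc n) = y)" by measurable
      from measure_path_first_step[OF this] show ?thesis by simp
    qed
    finally show ?case unfolding mc_accessible_def by blast
  qed
qed

section \<open>Maximum principle and states visited infinitely often\<close>

lemma pmf_mean_eq_max:
  fixes f :: "'s::finite \<Rightarrow> real"
  assumes mean: "(\<Sum>z\<in>UNIV. pmf p z * f z) = M" and le: "\<And>z. f z \<le> M" and z: "z \<in> set_pmf p"
  shows "f z = M"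
proof -
  \<comment> \<open>The deficits \<open>M - f z\<close> are nonnegative with weighted mean zero, so
    those of positive weight vanish.\<close>
  have "(\<Sum>z\<in>UNIV. pmf p z * (M - f z)) = 0"
    by (simp add: right_diff_distrib sum_subtractf mean sum_pmf_UNIV flip: sum_distrib_right)
  then have "\<forall>z\<in>UNIV. pmf p z * (M - f z) = 0"
    by (subst (asm) sum_nonneg_eq_0_iff) (auto simp: le)
  then show ?thesis using z by (auto simp: set_pmf_iff)
qed

lemma frequently_shift:
  fixes \<omega> :: "nat \<Rightarrow> 's"
  shows "(\<exists>\<^sub>\<infinity>n. P (\<omega> (n + k))) \<longleftrightarrow> (\<exists>\<^sub>\<infinity>n. P (\<omega> n))"
  by (metis frequently_def cofinite_eq_sequentially
      eventually_sequentially_seg[of "\<lambda>n. \<not> P (\<omega> n)" k])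

lemma frequently_case_nat:
  "(\<exists>\<^sub>\<infinity>n. P (case_nat s \<omega> n)) \<longleftrightarrow> (\<exists>\<^sub>\<infinity>n. P (\<omega> n))"
  unfolding frequently_shift[of P "case_nat s \<omega>" 1, symmetric]
  by (simp only: One_nat_def add_Suc_right add_0_right nat.case)

lemma pred_infinitely_often_avoiding:
  "Measurable.pred path_space (\<lambda>\<pi>. (\<exists>\<^sub>\<infinity>n. \<pi> n = x) \<and> (\<forall>n. \<pi> n \<noteq> y))"
  unfolding INFM_nat_le by measurable

text \<open>
  Maximum principle: the probability \<open>q s\<close> of the exceptional event from \<open>s\<close> is harmonic off \<open>y\<close>,
  so the set where it is maximal is closed under reachability. If the maximum were positive, this
  set would contain \<open>x\<close>, hence \<open>y\<close>, where \<open>q\<close> vanishes.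
\<close>

lemma AE_path_not_avoid:
  fixes K :: "'s::finite \<Rightarrow> 's pmf"
  assumes xy: "(x, y) \<in> (mc_edges K)\<^sup>*"
  shows "AE \<pi> in path_measure K s. \<not> ((\<exists>\<^sub>\<infinity>n. \<pi> n = x) \<and> (\<forall>n. \<pi> n \<noteq> y))"
proof -
  let ?B = "\<lambda>\<pi>. (\<exists>\<^sub>\<infinity>n. \<pi> n = x) \<and> (\<forall>n. \<pi> n \<noteq> y)"
  have B: "Measurable.pred path_space ?B" by (rule pred_infinitely_often_avoiding)
  define q where "q s = measure (path_measure K s) {\<pi>. ?B \<pi>}" for s
  define M where "M = Max (range q)"
  have le: "q s \<le> M" for s by (simp add: M_def)
  have "M \<in> range q" unfolding M_def by (rule Max_in) auto
  then obtain s0 where s0: "q s0 = M" by auto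
  have qy: "q y = 0"
    unfolding q_def measure_path_eq_0_iff[OF B]
    using AE_path_start[where K = K and s = y] by eventually_elim blast
  have "M = 0"
  proof (rule ccontr)
    assume M: "M \<noteq> 0"
    have closed: "q z = M" if "q s = M" "(s, z) \<in> (mc_edges K)\<^sup>*" for s z
      using that(2,1)
    proof (induction rule: converse_rtrancl_induct)
      case (step s t)
      \<comment> \<open>Prepending a state other than \<open>y\<close> affects neither the avoidance
        of \<open>y\<close> nor the infinitely many visits to \<open>x\<close>.\<close>
      have "s \<noteq> y" using qy step M by auto
      then have eq: "?B (case_nat s \<omega>) \<longleftrightarrow> ?B \<omega>" for \<omega>
        by (auto simp: frequently_case_nat[where P = "\<lambda>z. z = x"] split: nat.split)
      have "(\<Sum>z\<in>UNIV. pmf (K s) z * q z) = q s"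
        unfolding q_def measure_path_first_step[OF B, of K s] eq ..
      then have "q t = M"
        using step pmf_mean_eq_max[of "K s" q M t] le by auto
      then show ?case by (rule step.IH)
    qed
    \<comment> \<open>Otherwise paths from \<open>s0\<close> almost surely never meet
      \<open>x\<close>, which forces \<open>q s0 = 0\<close>.\<close>
    have "(s0, x) \<in> (mc_edges K)\<^sup>*"
    proof (rule ccontr)
      assume "(s0, x) \<notin> (mc_edges K)\<^sup>*"
      then have "AE \<pi> in path_measure K s0. \<forall>n. \<pi> n \<noteq> x"
        using AE_path_visits_reachable[where K = K and s = s0] by (auto elim: eventually_mono)
      then have "q s0 = 0"
        unfolding q_def measure_path_eq_0_iff[OF B] by eventually_elim simp
      with s0 M show False by simp
    qed
    then have "q y = M" using closed[OF s0] xy by (meson rtrancl_trans)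
    with qy M show False by simp
  qed
  then have "q s = 0"
    using le[of s] by (simp add: q_def order.antisym)
  then show ?thesis
    unfolding q_def measure_path_eq_0_iff[OF B] .
qed

text \<open>If \<open>x\<close> recurred but \<open>y\<close> did not, the path after its last visit
  to \<open>y\<close> would visit \<open>x\<close> infinitely often and avoid \<open>y\<close>.
  \<open>AE_path_not_avoid\<close> excludes this for each of the countably many shifts
  \<open>k\<close>.\<close>

lemma AE_path_infinitely_often_reachable:
  fixes K :: "'s::finite \<Rightarrow> 's pmf"
  shows "AE \<pi> in path_measure K s. \<forall>x y.
    (x, y) \<in> (mc_edges K)\<^sup>* \<longrightarrow> (\<exists>\<^sub>\<infinity>n. \<pi> n = x) \<longrightarrow> (\<exists>\<^sub>\<infinity>n. \<pi> n = y)"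
proof -
  have "AE \<pi> in path_measure K s. (\<exists>\<^sub>\<infinity>n. \<pi> n = x) \<longrightarrow> (\<exists>\<^sub>\<infinity>n. \<pi> n = y)"
    if xy: "(x, y) \<in> (mc_edges K)\<^sup>*" for x y
  proof -
    have B: "Measurable.pred path_space (\<lambda>\<pi>. \<not> ((\<exists>\<^sub>\<infinity>n. \<pi> n = x) \<and> (\<forall>n. \<pi> n \<noteq> y)))"
      by (intro pred_intros_logic(2) pred_infinitely_often_avoiding)
    have "AE \<pi> in path_measure K s. \<forall>k.
        \<not> ((\<exists>\<^sub>\<infinity>n. \<pi> (n + k) = x) \<and> (\<forall>n. \<pi> (n + k) \<noteq> y))"
      unfolding AE_all_countable by (rule allI) (rule AE_path_shift[OF B AE_path_not_avoid[OF xy]])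
    then show ?thesis
    proof eventually_elim
      case (elim \<pi>)
      show ?case
      proof (intro impI, rule ccontr)
        assume "\<exists>\<^sub>\<infinity>n. \<pi> n = x" "\<not> (\<exists>\<^sub>\<infinity>n. \<pi> n = y)"
        then obtain k where "\<forall>n\<ge>k. \<pi> n \<noteq> y" by (auto simp: INFM_nat_le)
        moreover have "\<exists>\<^sub>\<infinity>n. \<pi> (n + k) = x"
          using \<open>\<exists>\<^sub>\<infinity>n. \<pi> n = x\<close> frequently_shift[of "\<lambda>z. z = x" \<pi> k] by simp
        moreover have "\<forall>n. \<pi> (n + k) \<noteq> y"
          using \<open>\<forall>n\<ge>k. \<pi> n \<noteq> y\<close> by (metis le_add2)
        ultimately show False using elim by blast
      qed
    qed
  qed
  then show ?thesis by (simp add: AE_all_countable)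
qed

section \<open>Recurrence classes as closed communicating classes\<close>

lemma ex_infinitely_often:
  fixes \<pi> :: "nat \<Rightarrow> 's::finite"
  shows "\<exists>x. \<exists>\<^sub>\<infinity>n. \<pi> n = x"
proof -
  have "\<exists>\<^sub>\<infinity>n. \<exists>x\<in>UNIV. \<pi> n = x" by simp
  then show ?thesis by (subst (asm) INFM_finite_Bex_distrib) auto
qed

text \<open>Forward: almost sure hitting of \<open>x\<close> passes from a state to its successors,
  hence to everything reachable from \<open>x\<close>. Backward: some \<open>z\<close> is visited
  infinitely often; it is reachable from \<open>x\<close>, so it leads back to \<open>x\<close>,
  which is then visited infinitely often too.\<close>

lemma mc_recurrent_iff:
  fixes K :: "'s::finite \<Rightarrow> 's pmf"
  shows "mc_recurrent K x \<longleftrightarrow> (\<forall>y. (x, y) \<in> (mc_edges K)\<^sup>* \<longrightarrow> (y, x) \<in> (mc_edges K)\<^sup>*)"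
proof -
  have ret: "Measurable.pred path_space (\<lambda>\<pi>. \<exists>n>0. \<pi> n = x)" by measurable
  have hit: "Measurable.pred path_space (\<lambda>\<pi>. \<exists>n. \<pi> n = x)" by measurable
  let ?A = "\<lambda>s. AE \<pi> in path_measure K s. \<exists>n. \<pi> n = x"
  have rec: "mc_recurrent K x \<longleftrightarrow> (AE \<pi> in path_measure K x. \<exists>n>0. \<pi> n = x)"
    unfolding mc_recurrent_def by (rule measure_path_eq_1_iff[OF ret])
  show ?thesis
  proof
    assume "mc_recurrent K x"
    \<comment> \<open>Once the starting \<open>x\<close> is removed, a return at a positive time is
      a hit at any time.\<close>
    have "(\<exists>n>0. case_nat x \<omega> n = x) \<longleftrightarrow> (\<exists>n. \<omega> n = x)" for \<omega> :: "nat \<Rightarrow> 's"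
      by (metis gr0_implies_Suc old.nat.simps(5) zero_less_Suc)
    then have succ_x: "?A z" if "z \<in> set_pmf (K x)" for z
      using \<open>mc_recurrent K x\<close> that unfolding rec AE_path_first_step[OF ret] by simp
    have succ: "?A z" if "?A s" "z \<in> set_pmf (K s)" for s z
    \<comment> \<open>For \<open>s = x\<close> the hit at time 0 says nothing about later times, so
      that case rests on recurrence through \<open>succ_x\<close>.\<close>
    proof (cases "s = x")
      case False
      then have "(\<exists>n. case_nat s \<omega> n = x) \<longleftrightarrow> (\<exists>n. \<omega> n = x)" for \<omega> :: "nat \<Rightarrow> 's"
        by (metis not0_implies_Suc old.nat.simps(4,5))
      then show ?thesis
        using that unfolding AE_path_first_step[OF hit, of K s] by simp
    qed (use that succ_x in blast)
    show "\<forall>y. (x, y) \<in> (mc_edges K)\<^sup>* \<longrightarrow> (y, x) \<in> (mc_edges K)\<^sup>*"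
    proof (intro allI impI)
      fix y assume "(x, y) \<in> (mc_edges K)\<^sup>*"
      then have "?A y"
      proof (induction rule: rtrancl_induct)
        case base
        show ?case using AE_path_start by eventually_elim blast
      qed (use succ in blast)
      then have "AE \<pi> in path_measure K y. (y, x) \<in> (mc_edges K)\<^sup>*"
        using AE_path_visits_reachable by eventually_elim auto
      then show "(y, x) \<in> (mc_edges K)\<^sup>*"
        \<comment> \<open>The claim does not mention the path, and a constant that holds almost
          surely under a probability measure holds.\<close>
        by (simp only: prob_space.AE_const[OF prob_space_path_measure])
    qed
  next
    assume returns: "\<forall>y. (x, y) \<in> (mc_edges K)\<^sup>* \<longrightarrow> (y, x) \<in> (mc_edges K)\<^sup>*"
    show "mc_recurrent K x"
      unfolding rec
      using AE_path_visits_reachable AE_path_infinitely_often_reachable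
    proof eventually_elim
      case (elim \<pi>)
      obtain z where z: "\<exists>\<^sub>\<infinity>n. \<pi> n = z" using ex_infinitely_often by blast
      then obtain n where "\<pi> n = z" by (auto simp: INFM_nat_le)
      then have "(z, x) \<in> (mc_edges K)\<^sup>*" using elim(1) returns by blast
      then have "\<exists>\<^sub>\<infinity>n. \<pi> n = x" using elim(2) z by blast
      \<comment> \<open>The strict form \<open>INFM_nat\<close> yields a visit after time 0, as the
        return event requires.\<close>
      then show ?case by (auto simp: INFM_nat)
    qed
  qed
qed

text \<open>Everything reachable from a recurrent state leads back to it and is itself recurrent, so
  its communicating class is its whole forward closure. In particular classes cannot be
  left.\<close>

lemma recurrence_classes_iff:
  fixes K :: "'s::finite \<Rightarrow> 's pmf"
  shows "R \<in> recurrence_classes K \<longleftrightarrow> (\<exists>x. mc_recurrent K x \<and> R = (mc_edges K)\<^sup>* `` {x})"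
proof -
  have "{(x, y). mc_recurrent K x \<and> mc_recurrent K y \<and> mc_communicating K x y} `` {x} =
      (mc_edges K)\<^sup>* `` {x}" if "mc_recurrent K x" for x
    using that by (auto simp: mc_communicating_def mc_accessible_iff mc_recurrent_iff)
      (metis rtrancl_trans)
  then show ?thesis
    unfolding recurrence_classes_def quotient_def by auto
qed

text \<open>A class is the forward closure of each of its members, so a common member determines
  both classes.\<close>

lemma recurrence_classes_disjoint:
  fixes K :: "'s::finite \<Rightarrow> 's pmf"
  assumes "R \<in> recurrence_classes K" "R' \<in> recurrence_classes K" "x \<in> R" "x \<in> R'"
  shows "R = R'"
proof -
  have "R = (mc_edges K)\<^sup>* `` {x}" if "R \<in> recurrence_classes K" "x \<in> R" for R
  proof -
    from that obtain a where a: "mc_recurrent K a" "R = (mc_edges K)\<^sup>* `` {a}"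
      unfolding recurrence_classes_iff by blast
    with that have "(a, x) \<in> (mc_edges K)\<^sup>*" by simp
    moreover from this have "(x, a) \<in> (mc_edges K)\<^sup>*"
      using a(1) unfolding mc_recurrent_iff by blast
    ultimately show ?thesis
      unfolding a(2) by (metis (mono_tags, lifting) Image_singleton_iff rtrancl_trans subsetI subset_antisym)
  qed
  with assms show ?thesis by metis
qed

lemma AE_path_infinitely_often_class:
  fixes K :: "'s::finite \<Rightarrow> 's pmf"
  shows "AE \<pi> in path_measure K s. {x. \<exists>\<^sub>\<infinity>n. \<pi> n = x} \<in> recurrence_classes K \<and>
    (\<forall>R\<in>recurrence_classes K. (\<exists>n. \<pi> n \<in> R) \<longleftrightarrow> R = {x. \<exists>\<^sub>\<infinity>n. \<pi> n = x})"
  using AE_path_reachable AE_path_infinitely_often_reachable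
proof eventually_elim
  case (elim \<pi>)
  let ?I = "{x. \<exists>\<^sub>\<infinity>n. \<pi> n = x}"
  obtain x where x: "x \<in> ?I" using ex_infinitely_often by blast
  \<comment> \<open>A state visited infinitely often is visited again after every time
    \<open>n\<close>.\<close>
  have later: "(\<pi> n, y) \<in> (mc_edges K)\<^sup>*" if "y \<in> ?I" for n y
    using that elim(1) by (auto simp: INFM_nat_le)
  have from_I: "(y, z) \<in> (mc_edges K)\<^sup>*" if "y \<in> ?I" "z \<in> ?I" for y z
  proof -
    obtain n where "\<pi> n = y" using \<open>y \<in> ?I\<close> by (auto simp: INFM_nat_le)
    then show ?thesis using later[OF \<open>z \<in> ?I\<close>, of n] by simp
  qed
  \<comment> \<open>One inclusion is mutual reachability inside \<open>?I\<close>; the other holds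
    because infinitely many visits propagate along reachability.\<close>
  have I: "?I = (mc_edges K)\<^sup>* `` {x}"
    using from_I x elim(2) by blast
  have "mc_recurrent K x"
    unfolding mc_recurrent_iff using I from_I x by blast
  with I have rec_class: "?I \<in> recurrence_classes K"
    unfolding recurrence_classes_iff by blast
  have "R = ?I" if R: "R \<in> recurrence_classes K" "\<pi> n \<in> R" for R n
  proof -
    \<comment> \<open>\<open>R\<close> is closed under reachability and was entered at time
      \<open>n\<close>, and \<open>x\<close> is visited later.\<close>
    have "x \<in> R"
      using R later[OF x, of n] unfolding recurrence_classes_iff Image_singleton_iff
      by (metis Image_singleton_iff rtrancl_trans)
    then show ?thesis using recurrence_classes_disjoint[OF R(1) rec_class] x by blast
  qed
  moreover have "\<exists>n. \<pi> n \<in> ?I"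
  proof -
    have "\<exists>n. \<pi> n = x" using x by (auto simp: INFM_nat_le)
    with x show ?thesis by metis
  qed
  ultimately show ?case using rec_class by blast
qed

section \<open>Rabin acceptance and feasible recurrence classes\<close>

text \<open>By the pigeonhole principle on the finite state space, a set is visited infinitely often
  iff one of its members is. This holds for every path, not just almost surely.\<close>

lemma rabin_accepting_iff_feasible:
  fixes \<pi> :: "nat \<Rightarrow> 's::finite \<times> 'gd::finite \<times> 'ga::finite"
  shows "rabin_accepting F (\<lambda>n. fst (\<pi> n)) \<longleftrightarrow> feasible F {x. \<exists>\<^sub>\<infinity>n. \<pi> n = x}"
proof -
  have "infinite {n. fst (\<pi> n) \<in> B} \<longleftrightarrow> B \<inter> fst ` {x. \<exists>\<^sub>\<infinity>n. \<pi> n = x} \<noteq> {}" for B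
  proof -
    have "infinite {n. fst (\<pi> n) \<in> B} \<longleftrightarrow> (\<exists>\<^sub>\<infinity>n. \<exists>x\<in>fst -` B. \<pi> n = x)"
      by (simp add: frequently_cofinite vimage_def)
    also have "\<dots> \<longleftrightarrow> (\<exists>x\<in>fst -` B. \<exists>\<^sub>\<infinity>n. \<pi> n = x)"
      by (rule INFM_finite_Bex_distrib) simp
    finally show ?thesis by auto
  qed
  moreover from this have "finite {n. fst (\<pi> n) \<in> B} \<longleftrightarrow> B \<inter> fst ` {x. \<exists>\<^sub>\<infinity>n. \<pi> n = x} = {}" for B
    by metis
  ultimately show ?thesis
    unfolding rabin_accepting_def feasible_def by (simp only: conj_commute)
qed

lemma sat_prob_eq_sum_reach_prob:
  "sat_prob G Cd Ca = (\<Sum>R\<in>feasible_rec_sets G Cd Ca. reach_prob G Cd Ca R)"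
proof -
  let ?P = "gmc_paths G Cd Ca"
  interpret prob_space ?P
    unfolding gmc_paths_def by (rule prob_space_path_measure)
  have rec_class: "AE \<pi> in ?P. {x. \<exists>\<^sub>\<infinity>n. \<pi> n = x} \<in> recurrence_classes (gmc G Cd Ca) \<and>
      (\<forall>R\<in>recurrence_classes (gmc G Cd Ca). (\<exists>n. \<pi> n \<in> R) \<longleftrightarrow> R = {x. \<exists>\<^sub>\<infinity>n. \<pi> n = x})"
    unfolding gmc_paths_def by (rule AE_path_infinitely_often_class)
  have reach: "{\<pi>. \<exists>n. \<pi> n \<in> R} \<in> sets ?P" for R
    unfolding gmc_paths_def by (rule sets_reach)
  \<comment> \<open>Almost surely the limit set is the only class reached, so acceptance, which is
    its feasibility, amounts to reaching some feasible class.\<close>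
  have "sat_prob G Cd Ca = measure ?P (\<Union>R\<in>feasible_rec_sets G Cd Ca. {\<pi>. \<exists>n. \<pi> n \<in> R})"
    unfolding sat_prob_def
  proof (rule finite_measure_eq_AE)
    show "AE \<pi> in ?P. \<pi> \<in> {\<pi>. rabin_accepting (acc G) (\<lambda>n. fst (\<pi> n))} \<longleftrightarrow>
        \<pi> \<in> (\<Union>R\<in>feasible_rec_sets G Cd Ca. {\<pi>. \<exists>n. \<pi> n \<in> R})"
      using rec_class
      by eventually_elim (auto simp: rabin_accepting_iff_feasible feasible_rec_sets_def)
    show "{\<pi>. rabin_accepting (acc G) (\<lambda>n. fst (\<pi> n))} \<in> sets ?P"
      unfolding gmc_paths_def by (rule sets_rabin_accepting)
    show "(\<Union>R\<in>feasible_rec_sets G Cd Ca. {\<pi>. \<exists>n. \<pi> n \<in> R}) \<in> sets ?P"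
      by (intro sets.finite_UN reach) simp
  qed
  also have "\<dots> = (\<Sum>R\<in>feasible_rec_sets G Cd Ca. measure ?P {\<pi>. \<exists>n. \<pi> n \<in> R})"
  \<comment> \<open>As sets of sequences the events may overlap, since a sequence can follow
    transitions of probability zero; they are disjoint only almost surely.\<close>
  proof (rule measure_UNION_AE)
    show "pairwise (\<lambda>R R'. AE \<pi> in ?P. \<pi> \<notin> {\<pi>. \<exists>n. \<pi> n \<in> R} \<or> \<pi> \<notin> {\<pi>. \<exists>n. \<pi> n \<in> R'})
        (feasible_rec_sets G Cd Ca)"
    proof (rule pairwiseI)
      fix R R' assume "R \<in> feasible_rec_sets G Cd Ca" "R' \<in> feasible_rec_sets G Cd Ca" "R \<noteq> R'"
      then have "R \<in> recurrence_classes (gmc G Cd Ca)" "R' \<in> recurrence_classes (gmc G Cd Ca)"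
        by (simp_all add: feasible_rec_sets_def)
      note R = this \<open>R \<noteq> R'\<close>
      from rec_class show "AE \<pi> in ?P. \<pi> \<notin> {\<pi>. \<exists>n. \<pi> n \<in> R} \<or> \<pi> \<notin> {\<pi>. \<exists>n. \<pi> n \<in> R'}"
        by eventually_elim (use R in blast)
    qed
  qed (use reach in \<open>simp_all add: fmeasurable_eq_sets\<close>)
  finally show ?thesis
    by (simp add: reach_prob_def)
qed

theorem mainTheorem1:
  fixes SG :: "('s::finite, 'ud::finite, 'ua::finite, 'od::finite, 'oa::finite, 'ap) posg"
    and A :: "('q::finite, 'ap set) dra"
    and \<phi> :: "'ap ltl"
    and Cd :: "('gd::finite, 'od, 'ud) fsc"
    and Ca :: "('ga::finite, 'oa, 'ua) fsc"
  assumes "dra_represents A \<phi>"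
  shows "sat_prob (product_posg SG A) Cd Ca =
    (\<Sum>R\<in>feasible_rec_sets (product_posg SG A) Cd Ca. reach_prob (product_posg SG A) Cd Ca R)"
  by (rule sat_prob_eq_sum_reach_prob)

end
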